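(* Let $d\ge 1$. The semigroup $\mathrm{Sp}_+(d,\mathbb{C})$ of positive complex symplectic matrices is generated (as a semigroup under matrix multiplication) by the matrix $J$, by the matrices $\mathcal{D}_E$ with $E\in \mathrm{GL}(d,\mathbb{R})$, and by the matrices $V_Q$ with $Q\in\mathbb{C}^{d\times d}$ symmetric ($Q^\top=Q$) and with positive semi-definite imaginary part.
   Context: $I_d$, $O_d$ are the $d\times d$ identity and null matrices, and $$J=\begin{pmatrix} O_d & I_d\\ -I_d & O_d\end{pmatrix},\qquad \mathcal{D}_E=\begin{pmatrix}E^{-1}&O_d\\ O_d&E^\top\end{pmatrix},\qquad V_Q=\begin{pmatrix}I_d&O_d\\ Q&I_d\end{pmatrix}.$$ $\mathrm{Sp}(d,\mathbb{C})=\{S\in\mathbb{C}^{2d\times 2d}: S^\top J S=J\}$ (transpose, not Hermitian adjoint). Let $\sigma(z,w)=Jz\cdot w$ for $z,w\in\mathbb{C}^{2d}$, where $\cdot$ is the bilinear product $a\cdot b=\sum_j a_jb_j$. A matrix $S\in\mathrm{Sp}(d,\mathbb{C})$ is positive if $i^{-1}\big(\sigma(Sz,\overline{Sz})-\sigma(z,\overline z)\big)\ge 0$ for all $z\in\mathbb{C}^{2d}$; $\mathrm{Sp}_+(d,\mathbb{C})$ is the semigroup of positive matrices. *)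

theory Defs
  imports "HOL-Analysis.Analysis"
begin

text \<open>
  Matrices of size $2d \times 2d$ are indexed by the sum type \<open>'d + 'd\<close> with \<open>d = CARD('d)\<close>: the indices
  \<open>Inl\<close> enumerate the first block of coordinates and \<open>Inr\<close> the second one.
\<close>

definition block_matrix ::
  "'a^'d^'d \<Rightarrow> 'a^'d^'d \<Rightarrow> 'a^'d^'d \<Rightarrow> 'a^'d^'d \<Rightarrow> 'a^('d + 'd)^('d + 'd)" where
  "block_matrix A B C D = (\<chi> i j.
     case i of
       Inl k \<Rightarrow> (case j of Inl l \<Rightarrow> A $ k $ l | Inr l \<Rightarrow> B $ k $ l)
     | Inr k \<Rightarrow> (case j of Inl l \<Rightarrow> C $ k $ l | Inr l \<Rightarrow> D $ k $ l))"

definition J_mat :: "complex^('d::finite + 'd)^('d + 'd)" where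
  "J_mat = block_matrix 0 (mat 1) (- mat 1) 0"

definition D_mat :: "real^'d::finite^'d \<Rightarrow> complex^('d + 'd)^('d + 'd)" where
  "D_mat E = block_matrix
     (map_matrix complex_of_real (matrix_inv E)) 0
     0 (map_matrix complex_of_real (transpose E))"

definition V_mat :: "complex^'d::finite^'d \<Rightarrow> complex^('d + 'd)^('d + 'd)" where
  "V_mat Q = block_matrix (mat 1) 0 Q (mat 1)"

definition Sp :: "(complex^('d::finite + 'd)^('d + 'd)) set" where
  "Sp = {S. transpose S ** J_mat ** S = J_mat}"

text \<open>The product is bilinear; the inner product \<open>\<bullet>\<close> on \<open>complex^'n\<close> is a different, real-valued form.\<close>

definition bilin_dot :: "complex^'n::finite \<Rightarrow> complex^'n \<Rightarrow> complex" where
  "bilin_dot a b = (\<Sum>j\<in>UNIV. a $ j * b $ j)"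

definition cnj_vec :: "complex^'n \<Rightarrow> complex^'n" where
  "cnj_vec z = (\<chi> j. cnj (z $ j))"

definition sympl_form :: "complex^('d::finite + 'd) \<Rightarrow> complex^('d + 'd) \<Rightarrow> complex" where
  "sympl_form z w = bilin_dot (J_mat *v z) w"

definition positive_mat :: "complex^('d::finite + 'd)^('d + 'd) \<Rightarrow> bool" where
  "positive_mat S \<longleftrightarrow>
     (\<forall>z. inverse \<i> * (sympl_form (S *v z) (cnj_vec (S *v z)) - sympl_form z (cnj_vec z))
          \<in> \<real>\<^sub>\<ge>\<^sub>0)"

definition Sp_plus :: "(complex^('d::finite + 'd)^('d + 'd)) set" where
  "Sp_plus = {S \<in> Sp. positive_mat S}"

definition pos_semidef :: "real^'n::finite^'n \<Rightarrow> bool" where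
  "pos_semidef A \<longleftrightarrow> transpose A = A \<and> (\<forall>x. 0 \<le> x \<bullet> (A *v x))"

text \<open>The subsemigroup generated by \<open>G\<close>: all finite nonempty products, with no inverses and no
  identity adjoined.\<close>

inductive_set semigroup_generated ::
  "('a::semiring_1^'n::finite^'n) set \<Rightarrow> ('a^'n^'n) set"
  for G :: "('a^'n^'n) set" where
  generator: "A \<in> G \<Longrightarrow> A \<in> semigroup_generated G"
| product: "\<lbrakk>A \<in> semigroup_generated G; B \<in> semigroup_generated G\<rbrakk>
            \<Longrightarrow> A ** B \<in> semigroup_generated G"

end

theory Submission
  imports Defs
begin

text \<open>
  Put \<open>h(z) = Im \<sigma>(z, cnj z)\<close>, a Hermitian form. A symplectic \<open>S\<close> is positive when
  \<open>h(S z) - h(z) \<ge> 0\<close> for all \<open>z\<close>. The generators \<open>J\<close> and \<open>D_E\<close> are real and preserve \<open>h\<close>, while \<open>V_Q\<close>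
  increases it because \<open>Im Q\<close> is positive semi-definite (\<open>V_mat_positive\<close>); so everything generated is
  positive.

  For the converse, a positive \<open>S\<close> is reduced to a real symplectic matrix by splitting off rank-one
  factors. The Hermitian form \<open>h(S z) - h(z)\<close> is positive semi-definite and, unless \<open>S\<close> is real, one can
  subtract from it the square \<open>2\<beta> |\<sigma>(z, a)|\<^sup>2\<close> of a nonzero \<^emph>\<open>real\<close> linear functional so that it stays
  semi-definite and its kernel grows. This works because its range is the range of the transposed
  imaginary part of \<open>S\<close>, a real matrix. Such a square is the increment of \<open>h\<close> under the
  transvection \<open>T z = z - \<i>\<beta> \<sigma>(z, a) a\<close>, so \<open>S = S' T\<close> with \<open>S'\<close> positive and closer to being real
  (\<open>transvection_peel\<close>). After finitely many steps a real symplectic matrix is left.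

  Transvections along real vectors are conjugate, by products of \<open>J\<close> and real \<open>V_Q\<close>, to matrices \<open>V_Q\<close>
  with \<open>Q\<close> of rank one (\<open>transvection_generated\<close>). A real symplectic matrix with blocks \<open>A, B, C, D\<close>
  has a block factorisation into generators when \<open>A\<close> is invertible, and multiplication by a real \<open>V_Q\<close>
  achieves this: \<open>det (A + t B)\<close> is a polynomial in \<open>t\<close> that does not vanish at \<open>t = \<i>\<close>
  (\<open>real_Sp_generated\<close>).
\<close>

section \<open>Block vectors and block matrices\<close>

lemma sum_Plus_UNIV: "(\<Sum>i\<in>(UNIV::('a::finite+'b::finite) set). f i) = (\<Sum>k\<in>UNIV. f (Inl k)) + (\<Sum>k\<in>UNIV. f (Inr k))"
  using sum.Plus[of "UNIV :: 'a set" "UNIV :: 'b set" f] by (simp add: o_def)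

lemma map_matrix_nth [simp]: "map_matrix f A $ i $ j = f (A $ i $ j)"
  by (simp add: map_matrix_def)

definition join_vec :: "'a^'d \<Rightarrow> 'a^'d \<Rightarrow> 'a^('d + 'd)" where
  "join_vec x y = (\<chi> i. case i of Inl k \<Rightarrow> x $ k | Inr k \<Rightarrow> y $ k)"

lemma join_vec_nth [simp]: "join_vec x y $ Inl k = x $ k" "join_vec x y $ Inr k = y $ k"
  by (simp_all add: join_vec_def)

lemma block_nth [simp]:
  "block_matrix A B C D $ Inl k $ Inl l = A $ k $ l" "block_matrix A B C D $ Inl k $ Inr l = B $ k $ l"
  "block_matrix A B C D $ Inr k $ Inl l = C $ k $ l" "block_matrix A B C D $ Inr k $ Inr l = D $ k $ l"
  by (simp_all add: block_matrix_def)

lemma vec_eq_sum_iff: "z = w \<longleftrightarrow> (\<forall>k. z $ Inl k = w $ Inl k) \<and> (\<forall>k. z $ Inr k = w $ Inr k)"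
  by (simp add: vec_eq_iff split_sum_all)

lemma join_vec_cases: obtains x y where "z = join_vec x y"
proof
  show "z = join_vec (\<chi> k. z $ Inl k) (\<chi> k. z $ Inr k)" by (simp add: vec_eq_sum_iff)
qed

lemma join_vec_inject [simp]: "join_vec x y = join_vec x' y' \<longleftrightarrow> x = x' \<and> y = y'"
  by (auto simp: vec_eq_iff split_sum_all)

lemma block_mult:
  "block_matrix A B C D ** block_matrix A' B' C' D' =
   block_matrix (A ** A' + B ** C') (A ** B' + B ** D') (C ** A' + D ** C') (C ** B' + D ** D')"
  by (auto simp: vec_eq_sum_iff matrix_matrix_mult_def sum_Plus_UNIV)

lemma block_transpose:
  "transpose (block_matrix A B C D) = block_matrix (transpose A) (transpose C) (transpose B) (transpose D)"
  by (auto simp: vec_eq_sum_iff transpose_def)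

lemma block_vec:
  "block_matrix A B C D *v join_vec x y = join_vec (A *v x + B *v y) (C *v x + D *v y)"
  by (auto simp: vec_eq_sum_iff matrix_vector_mult_def sum_Plus_UNIV)

lemma block_eq_iff [simp]: "block_matrix A B C D = block_matrix A' B' C' D' \<longleftrightarrow> A = A' \<and> B = B' \<and> C = C' \<and> D = D'"
  by (auto simp: vec_eq_iff split_sum_all)

lemma block_cases: obtains A B C D where "S = block_matrix A B C D"
proof
  show "S = block_matrix (\<chi> k l. S $ Inl k $ Inl l) (\<chi> k l. S $ Inl k $ Inr l)
    (\<chi> k l. S $ Inr k $ Inl l) (\<chi> k l. S $ Inr k $ Inr l)"
    by (simp add: vec_eq_sum_iff)
qed

lemma transpose_simps [simp]:
  "transpose 0 = 0"
  "transpose (- A) = - transpose (A :: 'a::ring_1^'n^'m)"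
  "transpose (A + B) = transpose A + transpose B"
  "transpose (A - B) = transpose A - transpose B"
  by (simp_all add: transpose_def vec_eq_iff)

lemma matrix_add_rdistrib: "((A + B) ** C) = (A ** C) + (B ** C)"
  by (simp add: vec_eq_iff matrix_matrix_mult_def distrib_right sum.distrib)

lemma matrix_inv_mult:
  assumes "invertible A" shows "A ** matrix_inv A = mat 1" "matrix_inv A ** A = mat 1"
  using someI_ex[OF assms[unfolded invertible_def]] by (simp_all add: matrix_inv_def)

lemma matrix_inv_inv:
  assumes "invertible A" shows "invertible (matrix_inv A)" "matrix_inv (matrix_inv A) = A"
proof -
  show *: "invertible (matrix_inv A)"
    using matrix_inv_mult[OF assms] by (auto simp: invertible_def)
  show "matrix_inv (matrix_inv A) = A"
    by (metis matrix_inv_mult[OF assms] matrix_inv_mult[OF *] matrix_mul_assoc matrix_mul_lid matrix_mul_rid)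
qed

lemma block_one: "block_matrix (mat 1) 0 0 (mat 1) = mat 1"
  by (auto simp: vec_eq_sum_iff mat_def)

section \<open>The symplectic form and complex conjugation\<close>

lemma uminus_matrix_vector_mult [simp]: "(- A) *v x = - (A *v (x :: 'a::ring_1^'n::finite))"
  by (simp add: vec_eq_iff matrix_vector_mult_def sum_negf)

lemma sympl_form_join: "sympl_form (join_vec x y) (join_vec x' y') = bilin_dot y x' - bilin_dot x y'"
  by (auto simp: sympl_form_def J_mat_def block_vec bilin_dot_def sum_Plus_UNIV sum_negf)

lemma sympl_form_sum: "sympl_form z w = (\<Sum>k\<in>UNIV. z $ Inr k * w $ Inl k - z $ Inl k * w $ Inr k)"
  by (rule join_vec_cases[of z], rule join_vec_cases[of w]) (simp add: sympl_form_join bilin_dot_def sum_subtractf)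

lemma sympl_form_linear:
  "sympl_form (z + z') w = sympl_form z w + sympl_form z' w"
  "sympl_form (z - z') w = sympl_form z w - sympl_form z' w"
  "sympl_form (c *s z) w = c * sympl_form z w"
  "sympl_form z (w + w') = sympl_form z w + sympl_form z w'"
  "sympl_form z (w - w') = sympl_form z w - sympl_form z w'"
  "sympl_form z (c *s w) = c * sympl_form z w"
  by (simp_all add: sympl_form_sum algebra_simps sum_distrib_left sum.distrib sum_subtractf)

lemma sympl_form_swap: "sympl_form w z = - sympl_form z w"
  by (simp add: sympl_form_sum sum_negf[symmetric] algebra_simps)

lemma sympl_form_self [simp]: "sympl_form z z = 0"
  by (simp add: sympl_form_sum algebra_simps)

lemma cnj_vec_simps [simp]:
  "cnj_vec (cnj_vec z) = z"
  "cnj_vec (z + w) = cnj_vec z + cnj_vec w"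
  "cnj_vec (z - w) = cnj_vec z - cnj_vec w"
  "cnj_vec (c *s z) = cnj c *s cnj_vec z"
  "cnj_vec (join_vec x y) = join_vec (cnj_vec x) (cnj_vec y)"
  by (auto simp: cnj_vec_def vec_eq_iff split_sum_all)

definition cnj_mat :: "complex^'n^'m \<Rightarrow> complex^'n^'m" where
  "cnj_mat A = map_matrix cnj A"

lemma cnj_mat_simps [simp]:
  "cnj_mat (- A) = - cnj_mat A"
  "cnj_mat (mat 1) = mat 1"
  "cnj_mat (transpose A) = transpose (cnj_mat A)"
  "cnj_mat 0 = 0"
  by (simp_all add: cnj_mat_def vec_eq_iff transpose_def mat_def)

lemma cnj_mat_mult: "cnj_mat (A ** B) = cnj_mat A ** cnj_mat B"
  by (simp add: cnj_mat_def vec_eq_iff matrix_matrix_mult_def)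

lemma cnj_vec_mult: "cnj_vec (A *v x) = cnj_mat A *v cnj_vec x"
  by (simp add: cnj_mat_def cnj_vec_def vec_eq_iff matrix_vector_mult_def)

lemma cnj_mat_block [simp]:
  "cnj_mat (block_matrix A B C D) = block_matrix (cnj_mat A) (cnj_mat B) (cnj_mat C) (cnj_mat D)"
  by (simp add: cnj_mat_def vec_eq_sum_iff)

lemma sympl_form_cnj: "sympl_form (cnj_vec z) (cnj_vec w) = cnj (sympl_form z w)"
  by (simp add: sympl_form_sum cnj_vec_def)

lemma sympl_form_cnj_swap: "sympl_form w (cnj_vec z) = - cnj (sympl_form z (cnj_vec w))"
  by (metis cnj_vec_simps(1) sympl_form_cnj sympl_form_swap)

lemma sympl_form_nondegenerate:
  assumes "\<And>z. sympl_form z w = 0" shows "w = 0"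
proof (rule join_vec_cases[of w])
  fix x y assume w: "w = join_vec x y"
  have "x $ k = 0" for k
    using assms[of "join_vec 0 (axis k 1)"] by (simp add: w sympl_form_join bilin_dot_def axis_def if_distrib if_distribR sum.If_cases cong: if_cong)
  moreover have "y $ k = 0" for k
    using assms[of "join_vec (axis k 1) 0"] by (simp add: w sympl_form_join bilin_dot_def axis_def if_distrib if_distribR sum.If_cases cong: if_cong)
  ultimately show "w = 0" by (simp add: w vec_eq_sum_iff)
qed

lemma bilin_dot_transpose: "bilin_dot (A *v x) y = bilin_dot x (transpose A *v y)"
  unfolding bilin_dot_def matrix_vector_mult_def transpose_def
  by (simp add: sum_distrib_left sum_distrib_right) (subst sum.swap, simp add: algebra_simps)

lemma sympl_form_mult: "sympl_form (S *v z) (S *v w) = bilin_dot ((transpose S ** J_mat ** S) *v z) w"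
  unfolding sympl_form_def bilin_dot_transpose[of "transpose S" "J_mat *v (S *v z)" w, unfolded transpose_transpose, symmetric]
  by (simp only: matrix_vector_mul_assoc matrix_mul_assoc)

lemma bilin_dot_axis: "bilin_dot z (axis k 1) = z $ k"
  by (simp add: bilin_dot_def axis_def if_distrib sum.If_cases cong: if_cong)

lemma Sp_iff: "S \<in> Sp \<longleftrightarrow> (\<forall>z w. sympl_form (S *v z) (S *v w) = sympl_form z w)"
proof
  assume "\<forall>z w. sympl_form (S *v z) (S *v w) = sympl_form z w"
  then have "bilin_dot ((transpose S ** J_mat ** S) *v z) (axis k 1) = bilin_dot (J_mat *v z) (axis k 1)" for z k
    by (simp add: sympl_form_mult) (simp add: sympl_form_def)
  then show "S \<in> Sp" by (simp add: Sp_def bilin_dot_axis matrix_eq vec_eq_iff)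
qed (simp add: sympl_form_mult Sp_def, simp add: sympl_form_def)

lemma Sp_mult: "A \<in> Sp \<Longrightarrow> B \<in> Sp \<Longrightarrow> A ** B \<in> Sp"
  by (simp add: Sp_iff matrix_vector_mul_assoc[symmetric])

section \<open>The Hermitian form that positive matrices increase\<close>

text \<open>
  The quantity \<open>\<sigma>(z, cnj z)\<close> is purely imaginary, so division by \<open>\<i>\<close> in the definition of
  positivity amounts to taking the imaginary part; positivity says that \<open>S\<close> increases \<open>herm_form\<close>.
\<close>

definition herm_form :: "complex^('d::finite + 'd) \<Rightarrow> real" where
  "herm_form z = Im (sympl_form z (cnj_vec z))"

lemma sympl_form_cnj_self: "sympl_form z (cnj_vec z) = \<i> * of_real (herm_form z)"
proof -
  have "cnj (sympl_form z (cnj_vec z)) = - sympl_form z (cnj_vec z)"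
    by (metis sympl_form_cnj cnj_vec_simps(1) sympl_form_swap)
  then show ?thesis by (simp add: herm_form_def complex_eq_iff)
qed

lemma positive_mat_iff: "positive_mat S \<longleftrightarrow> (\<forall>z. herm_form z \<le> herm_form (S *v z))"
  unfolding positive_mat_def sympl_form_cnj_self by (simp add: complex_nonneg_Reals_iff)

lemma Sp_plus_iff: "S \<in> Sp_plus \<longleftrightarrow> S \<in> Sp \<and> (\<forall>z. herm_form z \<le> herm_form (S *v z))"
  by (simp add: Sp_plus_def positive_mat_iff)

text \<open>
  A real matrix commutes with conjugation, so for it the symplectic identity already preserves
  \<open>herm_form\<close>.
\<close>

lemma herm_form_real_Sp:
  assumes "S \<in> Sp" "cnj_mat S = S"
  shows "herm_form (S *v z) = herm_form z"
  using assms by (simp add: herm_form_def cnj_vec_mult Sp_iff)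

section \<open>Symplectic transvections\<close>

definition transvection :: "complex \<Rightarrow> complex^('d::finite + 'd) \<Rightarrow> complex^('d + 'd)^('d + 'd)" where
  "transvection c a = matrix (\<lambda>w. w + (c * sympl_form w a) *s a)"

lemma transvection_apply: "transvection c a *v w = w + (c * sympl_form w a) *s a"
  unfolding transvection_def
proof (rule matrix_works)
  show "Vector_Spaces.linear (*s) (*s) (\<lambda>w. w + (c * sympl_form w a) *s a)"
    by unfold_locales (simp_all add: sympl_form_linear algebra_simps vec_eq_iff)
qed

lemma transvection_Sp: "transvection c a \<in> Sp"
  unfolding Sp_iff transvection_apply
  by (simp add: sympl_form_linear algebra_simps) (simp add: sympl_form_swap[of a])

lemma transvection_inverse: "transvection c a ** transvection (- c) a = mat 1"
  by (simp add: matrix_eq matrix_vector_mul_assoc[symmetric] transvection_apply sympl_form_linear vec_eq_iff algebra_simps)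

text \<open>
  Along a real direction only the imaginary part of the coefficient changes \<open>herm_form\<close>, by a multiple
  of the square of a single linear functional. Such transvections with \<open>Im c \<le> 0\<close> are the rank-one
  building blocks of positive matrices.
\<close>

lemma herm_transvection:
  assumes "cnj_vec a = a"
  shows "herm_form (transvection c a *v w) = herm_form w - 2 * Im c * (cmod (sympl_form w a))\<^sup>2"
proof -
  have "sympl_form a (cnj_vec w) = - cnj (sympl_form w a)"
    by (metis assms sympl_form_cnj sympl_form_swap)
  moreover have "sympl_form (cnj_vec w) a = cnj (sympl_form w a)"
    by (metis assms sympl_form_cnj)
  ultimately show ?thesis
    unfolding herm_form_def transvection_apply
    by (simp add: assms sympl_form_linear cmod_def power2_eq_square algebra_simps)
qed

section \<open>Splitting off a transvection\<close>

text \<open>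
  The sesquilinear form whose diagonal values, divided by \<open>\<i>\<close>, are the increments of \<open>herm_form\<close>
  under \<open>S\<close>. It is skew-Hermitian, and \<open>S\<close> is positive when \<open>-\<i>\<close> times it is positive semi-definite.
\<close>

definition gap_form :: "complex^('d::finite + 'd)^('d + 'd) \<Rightarrow> complex^('d + 'd) \<Rightarrow> complex^('d + 'd) \<Rightarrow> complex" where
  "gap_form S z w = sympl_form (S *v z) (cnj_vec (S *v w)) - sympl_form z (cnj_vec w)"

lemma gap_form_swap: "gap_form S w z = - cnj (gap_form S z w)"
  unfolding gap_form_def sympl_form_cnj_swap[of "S *v w"] sympl_form_cnj_swap[of w] by simp

lemma gap_form_self: "gap_form S z z = \<i> * of_real (herm_form (S *v z) - herm_form z)"
  by (simp add: gap_form_def sympl_form_cnj_self algebra_simps)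

text \<open>
  The reason why the range of the increment contains \<^emph>\<open>real\<close> functionals: if \<open>S u\<close> is real, the
  conjugation in the first term of \<open>gap_form S w u\<close> disappears and \<open>S\<close> cancels by the symplectic
  identity. What is left is the pairing of \<open>w\<close> with \<open>2\<i> Im u\<close>.
\<close>

lemma gap_form_real_image:
  assumes "S \<in> Sp" "cnj_vec (S *v u) = S *v u"
  shows "gap_form S w u = sympl_form w (u - cnj_vec u)"
  using assms by (simp add: Sp_iff gap_form_def sympl_form_linear)

text \<open>
  The expansion behind the Cauchy-Schwarz inequality for the increment: the shift of \<open>w\<close> along \<open>u\<close>
  has the phase for which each of the two cross terms contributes \<open>- s |c|\<^sup>2\<close>.
\<close>

lemma gap_form_quadratic:
  fixes S w u s
  defines "c \<equiv> gap_form S w u"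
  shows "Im (gap_form S (w + (\<i> * of_real s * c) *s u) (w + (\<i> * of_real s * c) *s u))
    = Im (gap_form S w w) - 2 * s * (cmod c)\<^sup>2 + s\<^sup>2 * (cmod c)\<^sup>2 * Im (gap_form S u u)"
proof -
  define k where "k = \<i> * of_real s * c"
  have "gap_form S (w + k *s u) (w + k *s u)
    = gap_form S w w + cnj k * c + k * gap_form S u w + k * cnj k * gap_form S u u"
    by (simp add: c_def gap_form_def matrix_vector_right_distrib vec.scale sympl_form_linear algebra_simps)
  also have "\<dots> = gap_form S w w - \<i> * of_real (2 * s * (cmod c)\<^sup>2) + of_real (s\<^sup>2 * (cmod c)\<^sup>2) * gap_form S u u"
    unfolding gap_form_swap[of S u w] c_def[symmetric] of_real_mult complex_norm_square
    by (simp add: k_def power2_eq_square algebra_simps)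
  finally show ?thesis by (simp add: k_def)
qed

text \<open>
  This is the real kernel of the imaginary part of \<open>S\<close>; its dimension measures how close \<open>S\<close> is to
  being real.
\<close>

definition real_dom :: "complex^('d::finite + 'd)^('d + 'd) \<Rightarrow> (complex^('d + 'd)) set" where
  "real_dom S = {z. cnj_vec z = z \<and> cnj_vec (S *v z) = S *v z}"

text \<open>
  Let \<open>u = b + \<i> a\<close> with \<open>a\<close>, \<open>b\<close> real, \<open>a \<noteq> 0\<close> and \<open>S u\<close> real, and let \<open>\<gamma>\<close> be the increment of
  \<open>herm_form\<close> at \<open>u\<close>. The polar form of the increment at \<open>(w, u)\<close> is \<open>2\<i> \<sigma>(w, a)\<close>, so Cauchy-Schwarz
  bounds the increment at \<open>w\<close> from below by \<open>4 |\<sigma>(w, a)|\<^sup>2 / \<gamma>\<close>. This is exactly the increment caused by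
  the transvection \<open>T\<close> along \<open>a\<close> with coefficient \<open>- 2\<i> / \<gamma>\<close>; hence \<open>S T\<^sup>-\<^sup>1\<close> is still positive. The same
  choice of coefficient gives \<open>T u = b\<close>, so \<open>S T\<^sup>-\<^sup>1\<close> maps the real vector \<open>b\<close> to the real vector \<open>S u\<close>,
  while \<open>T\<close> fixes every vector of \<open>real_dom S\<close>: the real domain grows.
\<close>

lemma transvection_peel:
  assumes S: "S \<in> Sp" and pos: "\<And>z. herm_form z \<le> herm_form (S *v z)"
    and u: "cnj_vec (S *v u) = S *v u" "cnj_vec u \<noteq> u"
  obtains a \<beta> S' where "cnj_vec a = a" "\<beta> \<ge> 0" "S = S' ** transvection (- \<i> * of_real \<beta>) a"
    "S' \<in> Sp" "\<And>z. herm_form z \<le> herm_form (S' *v z)" "real_dom S \<subset> real_dom S'"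
proof -
  define a where "a = (- \<i> / 2) *s (u - cnj_vec u)"
  define b where "b = (1 / 2) *s (u + cnj_vec u)"
  define \<gamma> where "\<gamma> = herm_form (S *v u) - herm_form u"
  define \<beta> where "\<beta> = 2 / \<gamma>"
  define T where "T = transvection (- \<i> * of_real \<beta>) a"
  define T' where "T' = transvection (\<i> * of_real \<beta>) a"
  define S' where "S' = S ** T'"
  have a: "cnj_vec a = a" and b: "cnj_vec b = b" and ab: "u = b + \<i> *s a" and "u - cnj_vec u = (2 * \<i>) *s a"
    by (simp_all add: a_def b_def vec_eq_iff cnj_vec_def field_simps)
  then have gap_u: "gap_form S w u = 2 * \<i> * sympl_form w a" for w
    using gap_form_real_image[OF S u(1)] by (simp add: sympl_form_linear)
  have "a \<noteq> 0"
    using u(2) by (auto simp: a_def vec_eq_iff)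
  then obtain v where v: "sympl_form v a \<noteq> 0"
    using sympl_form_nondegenerate by blast
  have ineq: "0 \<le> (herm_form (S *v w) - herm_form w) - 8 * s * (cmod (sympl_form w a))\<^sup>2 + 4 * s\<^sup>2 * (cmod (sympl_form w a))\<^sup>2 * \<gamma>" for w s
  proof -
    have "0 \<le> Im (gap_form S z z)" for z
      using pos[of z] by (simp add: gap_form_self)
    from this[of "w + (\<i> * of_real s * gap_form S w u) *s u"] show ?thesis
      unfolding gap_form_quadratic unfolding gap_form_self gap_u \<gamma>_def
      by (simp add: norm_mult power_mult_distrib algebra_simps)
  qed
  (* For \<gamma> = 0 the lower bound would be affine in s, hence \<sigma>(_, a) = 0,
     against nondegeneracy. *)
  have "\<gamma> \<noteq> 0"
  proof
    assume "\<gamma> = 0"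
    define p where "p = (cmod (sympl_form v a))\<^sup>2"
    have "p > 0" using v by (simp add: p_def)
    then show False
      using ineq[of v "(herm_form (S *v v) - herm_form v + 1) / (8 * p)"]
      unfolding p_def[symmetric] \<open>\<gamma> = 0\<close> by simp
  qed
  then have "\<gamma> > 0" using pos[of u] by (simp add: \<gamma>_def)
  have ua: "sympl_form u a = of_real (\<gamma> / 2)"
    using gap_u[of u] by (simp add: gap_form_self \<gamma>_def)
  have TT': "T' ** T = mat 1" "T ** T' = mat 1"
    using transvection_inverse[of "\<i> * of_real \<beta>" a] transvection_inverse[of "- \<i> * of_real \<beta>" a]
    by (simp_all add: T_def T'_def)
  have S'T: "S = S' ** T"
    by (simp add: S'_def matrix_mul_assoc[symmetric] TT')
  have Tu: "T *v u = b"
    using \<open>\<gamma> > 0\<close> by (simp add: T_def transvection_apply ua \<beta>_def) (simp add: ab vec_eq_iff)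
  (* If z and S z are real, the increment form vanishes against z by the symplectic identity. *)
  have fixed: "sympl_form z a = 0" if "z \<in> real_dom S" for z
  proof -
    have "gap_form S u z = 0"
      using gap_form_real_image[OF S, of z u] that by (simp add: real_dom_def sympl_form_sum)
    then have "gap_form S z u = 0"
      by (simp add: gap_form_swap[of S z u])
    then show ?thesis by (simp add: gap_u)
  qed
  have fixed': "T *v z = z" if "z \<in> real_dom S" for z
    using fixed[OF that] by (simp add: T_def transvection_apply)
  show ?thesis
  proof
    show "cnj_vec a = a" "\<beta> \<ge> 0" "S = S' ** transvection (- \<i> * of_real \<beta>) a"
      using a \<open>\<gamma> > 0\<close> S'T by (simp_all add: \<beta>_def T_def)
    show "S' \<in> Sp" unfolding S'_def T'_def by (intro Sp_mult S transvection_Sp)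
    show "herm_form z \<le> herm_form (S' *v z)" for z
    proof -
      define w where "w = T' *v z"
      have z: "z = T *v w" "S' *v z = S *v w"
        by (simp_all add: w_def S'_def TT' matrix_vector_mul_assoc)
      have "herm_form z = herm_form w + 2 * \<beta> * (cmod (sympl_form w a))\<^sup>2"
        using herm_transvection[OF a, of "- \<i> * of_real \<beta>" w] by (simp add: z T_def)
      then show ?thesis
        (* s = 1 / \<gamma> minimises the right-hand side of the inequality. *)
        using ineq[of w "1 / \<gamma>"] \<open>\<gamma> > 0\<close> by (simp add: z(2) \<beta>_def power2_eq_square)
    qed
    show "real_dom S \<subset> real_dom S'"
    proof
      show "real_dom S \<subseteq> real_dom S'"
      proof
        fix z assume z: "z \<in> real_dom S"
        have "S' *v z = S *v z"
          by (metis S'T fixed'[OF z] matrix_vector_mul_assoc)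
        then show "z \<in> real_dom S'" using z by (simp add: real_dom_def)
      qed
      have "S' *v b = S *v u"
        by (simp add: Tu[symmetric] S'T matrix_vector_mul_assoc)
      then have "b \<in> real_dom S'" using b u(1) by (simp add: real_dom_def)
      moreover have "b \<notin> real_dom S"
      proof
        assume "b \<in> real_dom S"
        then have "sympl_form u a = 0" using fixed by (simp add: ab sympl_form_linear)
        then show False using ua \<open>\<gamma> > 0\<close> by simp
      qed
      ultimately show "real_dom S \<noteq> real_dom S'" by blast
    qed
  qed
qed

section \<open>The generated semigroup and its transvections\<close>

definition Sp_plus_generators :: "(complex^('d::finite + 'd)^('d + 'd)) set" where
  "Sp_plus_generators = {J_mat} \<union> {D_mat E | E. invertible E}
     \<union> {V_mat Q | Q. transpose Q = Q \<and> pos_semidef (map_matrix Im Q)}"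

abbreviation generated :: "(complex^('d::finite + 'd)^('d + 'd)) set" where
  "generated \<equiv> semigroup_generated Sp_plus_generators"

lemma V_mat_mult: "V_mat Q ** V_mat Q' = V_mat (Q + Q')"
  by (simp add: V_mat_def block_mult)

lemma V_mat_0: "V_mat 0 = mat 1"
  by (simp add: V_mat_def block_one)

lemma V_mat_generated: "transpose Q = Q \<Longrightarrow> pos_semidef (map_matrix Im Q) \<Longrightarrow> V_mat Q \<in> generated"
  by (rule semigroup_generated.generator) (auto simp: Sp_plus_generators_def)

lemma V_mat_real_generated:
  assumes "transpose Q = Q" "cnj_mat Q = Q"
  shows "V_mat Q \<in> generated"
proof -
  have "map_matrix Im Q = 0"
    using assms(2) by (simp add: cnj_mat_def vec_eq_iff complex_eq_iff)
  then have "pos_semidef (map_matrix Im Q)"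
    by (simp only:) (simp add: pos_semidef_def)
  then show ?thesis
    by (intro V_mat_generated assms(1))
qed

lemma J_mat_generated: "J_mat \<in> generated"
  by (rule semigroup_generated.generator) (simp add: Sp_plus_generators_def)

definition J_inv :: "complex^('d::finite + 'd)^('d + 'd)" where
  "J_inv = block_matrix 0 (- mat 1) (mat 1) 0"

lemma uminus_matrix_mult [simp]:
  "(- A) ** B = - (A ** (B :: 'a::ring_1^'k^'n::finite))" "A ** (- B) = - (A ** B)"
  by (simp_all add: vec_eq_iff matrix_matrix_mult_def sum_negf)

lemma J_inv_eq: "J_inv = J_mat ** J_mat ** J_mat"
  by (simp add: J_inv_def J_mat_def block_mult)

lemma J_inv_generated: "J_inv \<in> generated"
  by (simp add: J_inv_eq semigroup_generated.product J_mat_generated)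

lemma J_mat_J_inv: "J_mat ** J_inv = mat 1"
  by (simp add: J_inv_def J_mat_def block_mult block_one)

lemma J_conj_V: "J_mat ** V_mat Q ** J_inv = block_matrix (mat 1) (- Q) 0 (mat 1)"
  by (simp add: J_inv_def J_mat_def V_mat_def block_mult)

lemma J_mat_Sp: "J_mat \<in> Sp"
  by (simp add: Sp_def J_mat_def block_mult block_transpose)

lemma V_mat_Sp: "V_mat Q \<in> Sp \<longleftrightarrow> transpose Q = Q"
  by (simp add: Sp_def J_mat_def V_mat_def block_mult block_transpose) (auto simp: add_eq_0_iff2)

lemma transvection_conj:
  assumes "R \<in> Sp" "R ** R' = mat 1"
  shows "transvection c (R *v a) = R ** transvection c a ** R'"
proof -
  have "transvection c (R *v a) *v w = (R ** transvection c a ** R') *v w" for w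
  proof -
    have w: "R *v (R' *v w) = w" by (simp add: matrix_vector_mul_assoc assms)
    then have "sympl_form w (R *v a) = sympl_form (R' *v w) a"
      using assms(1) unfolding Sp_iff by metis
    then show ?thesis
      by (simp add: matrix_vector_mul_assoc[symmetric] transvection_apply matrix_vector_right_distrib w vec.scale)
  qed
  then show ?thesis by (simp add: matrix_eq)
qed

text \<open>
  Conjugation reduces every transvection along a real vector to this case.
\<close>

lemma transvection_vertical:
  "transvection c (join_vec 0 a) = V_mat (\<chi> k l. - c * a $ k * a $ l)"
  unfolding matrix_eq
proof
  fix w :: "complex^('a + 'a)"
  obtain x y where w: "w = join_vec x y" by (rule join_vec_cases)
  show "transvection c (join_vec 0 a) *v w = V_mat (\<chi> k l. - c * a $ k * a $ l) *v w"
    unfolding w transvection_apply V_mat_def block_vec sympl_form_join matrix_vector_mul_lid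
    by (simp add: vec_eq_sum_iff bilin_dot_def matrix_vector_mult_def sum_distrib_left sum_distrib_right sum_negf mult_ac)
qed

lemma cnj_vec_fixed_iff: "cnj_vec z = z \<longleftrightarrow> (\<forall>k. Im (z $ k) = 0)"
  by (auto simp: cnj_vec_def vec_eq_iff complex_eq_iff)

lemma transvection_vertical_generated:
  assumes a: "cnj_vec a = a" and c: "Im c \<le> 0"
  shows "transvection c (join_vec 0 a) \<in> generated"
  unfolding transvection_vertical
proof (rule V_mat_generated)
  show "transpose (\<chi> k l. - c * a $ k * a $ l) = (\<chi> k l. - c * a $ k * a $ l)"
    by (simp add: transpose_def vec_eq_iff)
  have Im: "map_matrix Im (\<chi> k l. - c * a $ k * a $ l) = (\<chi> k l. - Im c * Re (a $ k) * Re (a $ l))"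
    using a unfolding cnj_vec_fixed_iff by (simp add: vec_eq_iff)
  have "x \<bullet> ((\<chi> k l. - Im c * Re (a $ k) * Re (a $ l)) *v x) = - Im c * (\<Sum>k\<in>UNIV. Re (a $ k) * x $ k)\<^sup>2" for x
    by (simp add: inner_vec_def matrix_vector_mult_def power2_eq_square sum_product sum_distrib_left sum_distrib_right sum_negf mult_ac)
  then show "pos_semidef (map_matrix Im (\<chi> k l. - c * a $ k * a $ l))"
    unfolding Im using c by (simp add: pos_semidef_def transpose_def vec_eq_iff mult_ac mult_nonneg_nonpos2 mult_nonpos_nonneg)
qed

text \<open>
  With \<open>n = p \<cdot> p\<close> and \<open>m = p \<cdot> q\<close>, the symmetric matrix \<open>(q p\<^sup>T + p q\<^sup>T) / n\<close> maps \<open>p\<close> to \<open>q + (m / n) p\<close>;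
  a multiple of \<open>p p\<^sup>T\<close> removes the excess. Since \<open>p\<close> is real and nonzero, \<open>n > 0\<close>.
\<close>

lemma symmetric_matrix_prescribed:
  assumes p: "cnj_vec p = p" "p \<noteq> 0" and q: "cnj_vec q = q"
  obtains Q where "transpose Q = Q" "cnj_mat Q = Q" "Q *v p = q"
proof -
  define n where "n = bilin_dot p p"
  define m where "m = bilin_dot p q"
  define Q where "Q = (\<chi> k l. (q $ k * p $ l + p $ k * q $ l) / n - m * p $ k * p $ l / n\<^sup>2)"
  have "n = of_real (\<Sum>k\<in>UNIV. (Re (p $ k))\<^sup>2)"
    using p(1) by (simp add: n_def bilin_dot_def cnj_vec_fixed_iff complex_eq_iff power2_eq_square)
  moreover have "(\<Sum>k\<in>UNIV. (Re (p $ k))\<^sup>2) \<noteq> 0"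
    using p unfolding cnj_vec_fixed_iff by (auto simp: sum_nonneg_eq_0_iff vec_eq_iff complex_eq_iff)
  ultimately have n: "n \<noteq> 0" "cnj n = n" by (simp_all del: of_real_sum)
  have sums: "(\<Sum>l\<in>UNIV. p $ l * p $ l) = n" "(\<Sum>l\<in>UNIV. p $ l * q $ l) = m"
    by (simp_all add: n_def m_def bilin_dot_def)
  have pk: "cnj (p $ k) = p $ k" "cnj (q $ k) = q $ k" for k
    using p(1) q by (simp_all add: cnj_vec_def vec_eq_iff)
  then have "cnj m = m" by (simp add: m_def bilin_dot_def)
  show ?thesis
  proof
    show "transpose Q = Q" by (simp add: Q_def transpose_def vec_eq_iff algebra_simps)
    show "cnj_mat Q = Q" using \<open>cnj m = m\<close> n pk by (simp add: Q_def cnj_mat_def vec_eq_iff)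
    have "(Q *v p) $ k = q $ k" for k
    proof -
      have "(Q *v p) $ k = (\<Sum>l\<in>UNIV. q $ k / n * (p $ l * p $ l) + p $ k / n * (p $ l * q $ l)
          - m * p $ k / n\<^sup>2 * (p $ l * p $ l))"
        by (simp add: Q_def matrix_vector_mult_def algebra_simps add_divide_distrib)
      also have "\<dots> = q $ k / n * n + p $ k / n * m - m * p $ k / n\<^sup>2 * n"
        by (simp only: sum_subtractf sum.distrib sum_distrib_left[symmetric] sums)
      also have "\<dots> = q $ k" using n by (simp add: field_simps power2_eq_square)
      finally show ?thesis .
    qed
    then show "Q *v p = q" by (simp add: vec_eq_iff)
  qed
qed

text \<open>
  Every real vector is the image of a vertical one under a product of \<open>J\<close> and a real \<open>V_mat Q\<close>, and
  conjugation by a symplectic matrix moves the direction of a transvection.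
\<close>

lemma transvection_generated:
  assumes a: "cnj_vec a = a" and c: "Im c \<le> 0"
  shows "transvection c a \<in> generated"
proof (rule join_vec_cases[of a])
  fix p q assume pq: "a = join_vec p q"
  with a have p: "cnj_vec p = p" and q: "cnj_vec q = q" by simp_all
  show ?thesis
  proof (cases "p = 0")
    case True
    then show ?thesis using transvection_vertical_generated[OF q c] pq by simp
  next
    case False
    then obtain Q where Q: "transpose Q = Q" "cnj_mat Q = Q" "Q *v p = q"
      using symmetric_matrix_prescribed p q by blast
    have Q': "transpose (- Q) = - Q" "cnj_mat (- Q) = - Q"
      using Q by (simp_all add: transpose_def vec_eq_iff)
    (* J maps (0, p) to (p, 0), and V_Q maps (p, 0) to (p, q). *)
    define R where "R = V_mat Q ** J_mat"
    define R' where "R' = J_inv ** V_mat (- Q)"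
    have "R *v join_vec 0 p = a"
      by (simp add: R_def pq V_mat_def J_mat_def block_mult block_vec Q)
    moreover have "R \<in> Sp" by (simp add: R_def Sp_mult V_mat_Sp Q J_mat_Sp)
    moreover have "R ** R' = mat 1"
      by (metis J_mat_J_inv R'_def R_def V_mat_0 V_mat_mult add.right_inverse matrix_mul_assoc matrix_mul_rid)
    ultimately have "transvection c a = R ** transvection c (join_vec 0 p) ** R'"
      using transvection_conj by metis
    moreover have "R \<in> generated" "R' \<in> generated"
      unfolding R_def R'_def by (intro semigroup_generated.product V_mat_real_generated J_mat_generated J_inv_generated Q Q')+
    ultimately show ?thesis
      using transvection_vertical_generated[OF p c] by (simp add: semigroup_generated.product)
  qed
qed

section \<open>Real symplectic matrices are generated\<close>

text \<open>
  \<open>det (A + x B)\<close> is a polynomial in \<open>x\<close>; if it does not vanish at some complex point, it cannot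
  vanish on the whole real line.
\<close>

lemma real_shift_invertible:
  fixes A B :: "complex^'n::finite^'n"
  assumes "det (\<chi> k l. A $ k $ l + c * B $ k $ l) \<noteq> 0"
  obtains t :: real where "det (\<chi> k l. A $ k $ l + of_real t * B $ k $ l) \<noteq> 0"
proof -
  define p where "p = det (\<chi> k l. [:A $ k $ l, B $ k $ l:])"
  have p: "poly p x = det (\<chi> k l. A $ k $ l + x * B $ k $ l)" for x
    by (simp add: p_def det_def poly_sum poly_prod of_int_poly)
  have "p \<noteq> 0" using assms p by force
  then have "finite {x. poly p x = 0}" by (rule poly_roots_finite)
  moreover have "infinite (range complex_of_real)"
    by (simp add: finite_image_iff inj_on_def infinite_UNIV_char_0)
  ultimately have "\<not> range complex_of_real \<subseteq> {x. poly p x = 0}"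
    using finite_subset by blast
  then show ?thesis using that p by auto
qed

lemma Sp_block_iff: "block_matrix A B C D \<in> Sp \<longleftrightarrow>
    transpose A ** C = transpose C ** A \<and> transpose B ** D = transpose D ** B \<and>
    transpose A ** D - transpose C ** B = mat 1"
proof -
  have eq: "transpose (transpose D ** A - transpose B ** C) = transpose A ** D - transpose C ** B"
    by (simp add: matrix_transpose_mul)
  have "transpose D ** A - transpose B ** C = mat 1 \<longleftrightarrow> transpose A ** D - transpose C ** B = mat 1"
    by (metis eq transpose_mat transpose_transpose)
  then show ?thesis
    by (simp add: Sp_def J_mat_def block_mult block_transpose) (auto simp: algebra_simps)
qed

lemma map_of_real_mult: "map_matrix complex_of_real (A ** B) = map_matrix complex_of_real A ** map_matrix complex_of_real B"
  by (simp add: vec_eq_iff matrix_matrix_mult_def)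

lemma map_of_real_simps:
  "map_matrix complex_of_real (mat 1) = mat 1"
  "map_matrix complex_of_real (transpose E) = transpose (map_matrix complex_of_real E)"
  "cnj_mat (map_matrix complex_of_real E) = map_matrix complex_of_real E"
  by (simp_all add: vec_eq_iff mat_def transpose_def cnj_mat_def)

lemma D_mat_Sp:
  assumes "invertible E" shows "D_mat E \<in> Sp"
proof -
  have "transpose (map_matrix complex_of_real (matrix_inv E)) ** map_matrix complex_of_real (transpose E) = mat 1"
    by (metis assms map_of_real_mult map_of_real_simps(1,2) matrix_inv_mult(1) matrix_transpose_mul transpose_mat)
  then show ?thesis by (simp add: D_mat_def Sp_block_iff)
qed

text \<open>
  Block elimination: with \<open>Q = C A\<^sup>-\<^sup>1\<close> and \<open>P = A\<^sup>-\<^sup>1 B\<close>, which the symplectic relations make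
  symmetric, the matrix is the product of a lower unitriangular, a block diagonal and an upper
  unitriangular factor. The last one is \<open>V_mat (- P)\<close> conjugated by \<open>J\<close>.
\<close>

lemma real_Sp_generated_free:
  assumes S: "block_matrix A B C D \<in> Sp" and re: "cnj_mat (block_matrix A B C D) = block_matrix A B C D"
    and A: "det A \<noteq> 0"
  shows "block_matrix A B C D \<in> generated"
proof -
  define E where "E = map_matrix Re A"
  have re': "cnj_mat A = A" "cnj_mat B = B" "cnj_mat C = C"
    using re by simp_all
  have cA: "map_matrix complex_of_real E = A"
    using re'(1) by (simp add: E_def cnj_mat_def vec_eq_iff complex_eq_iff)
  have "det A = of_real (det E)"
    unfolding cA[symmetric] det_def by simp
  then have E: "invertible E" using A by (simp add: invertible_det_nz)
  define L where "L = map_matrix complex_of_real (matrix_inv E)"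
  define N where "N = transpose L"
  have LA: "L ** A = mat 1" and AL: "A ** L = mat 1"
    unfolding L_def cA[symmetric] map_of_real_mult[symmetric] by (simp_all add: E matrix_inv_mult map_of_real_simps)
  have NA: "N ** transpose A = mat 1"
    by (metis AL N_def matrix_transpose_mul transpose_mat)
  have D: "D_mat (matrix_inv E) = block_matrix A 0 0 N"
    using E by (simp add: D_mat_def matrix_inv_inv cA N_def L_def map_of_real_simps)
  have AC: "transpose A ** C = transpose C ** A" and BD: "transpose B ** D = transpose D ** B"
    and AD: "transpose A ** D = mat 1 + transpose C ** B"
    using S by (auto simp: Sp_block_iff algebra_simps)
  define Q where "Q = C ** L"
  define P where "P = L ** B"
  have QN: "Q = N ** transpose C"
  proof -
    have "Q = N ** (transpose A ** C) ** L" by (simp add: Q_def matrix_mul_assoc NA)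
    also have "\<dots> = N ** transpose C ** (A ** L)" by (simp add: AC matrix_mul_assoc)
    finally show ?thesis by (simp add: AL)
  qed
  have QA: "Q ** A = C" and AP: "A ** P = B"
    by (simp_all only: Q_def P_def matrix_mul_assoc[of A] matrix_mul_assoc[of C, symmetric] LA AL matrix_mul_lid matrix_mul_rid)
  from QN have Q: "transpose Q = Q"
    by (simp add: Q_def N_def matrix_transpose_mul)
  have DQ: "D = Q ** B + N"
  proof -
    have "D = N ** (transpose A ** D)" by (simp add: matrix_mul_assoc NA)
    also have "\<dots> = N + Q ** B" by (simp add: AD QN matrix_add_ldistrib matrix_mul_assoc)
    finally show ?thesis by simp
  qed
  have P: "transpose P = P"
  proof -
    have "transpose B ** Q ** B + transpose B ** N = transpose B ** Q ** B + transpose N ** B"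
      using BD unfolding DQ by (simp add: matrix_transpose_mul Q matrix_add_ldistrib matrix_add_rdistrib matrix_mul_assoc)
    then show ?thesis by (simp add: P_def N_def matrix_transpose_mul)
  qed
  have L: "cnj_mat L = L"
    by (simp add: L_def map_of_real_simps)
  have "block_matrix A B C D = V_mat Q ** D_mat (matrix_inv E) ** (J_mat ** V_mat (- P) ** J_inv)"
    unfolding D J_conj_V unfolding V_mat_def block_mult
    by (simp add: AP QA) (simp add: DQ P_def Q_def matrix_mul_assoc)
  moreover have "V_mat Q \<in> generated" "V_mat (- P) \<in> generated"
    using Q P L re' by (auto intro!: V_mat_real_generated simp: Q_def P_def cnj_mat_mult)
  moreover have "D_mat (matrix_inv E) \<in> generated"
    using matrix_inv_inv(1)[OF E] by (intro semigroup_generated.generator) (auto simp: Sp_plus_generators_def)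
  ultimately show ?thesis
    by (auto intro!: semigroup_generated.product J_mat_generated J_inv_generated)
qed

text \<open>
  Multiplication by \<open>V_mat (t I)\<close> on the right replaces the block \<open>A\<close> by \<open>A + t B\<close>, so some real
  \<open>t\<close> with invertible \<open>A + t B\<close> is enough. At \<open>t = \<i>\<close> the block is always invertible: if
  \<open>(A + \<i> B) x = 0\<close>, then \<open>S\<close> maps \<open>(x, \<i> x)\<close>, where \<open>herm_form\<close> is \<open>2 |x|\<^sup>2\<close>, to a vector with
  vanishing first block, where \<open>herm_form\<close> is zero.
\<close>

lemma real_Sp_generated:
  assumes S: "S \<in> Sp" and re: "cnj_mat S = S"
  shows "S \<in> generated"
proof (rule block_cases[of S])
  fix A B C D assume block: "S = block_matrix A B C D"
  define M where "M = (\<chi> k l. A $ k $ l + \<i> * B $ k $ l)"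
  have "det M \<noteq> 0"
  proof
    assume "det M = 0"
    then have "\<not> (\<exists>L. L ** M = mat 1)"
      by (simp add: invertible_det_nz invertible_left_inverse[symmetric])
    then obtain x where x: "x \<noteq> 0" "M *v x = 0"
      by (auto simp: matrix_left_invertible_ker)
    define z where "z = join_vec x (\<i> *s x)"
    have "A *v x + B *v (\<i> *s x) = M *v x"
      by (simp add: M_def vec_eq_iff matrix_vector_mult_def sum.distrib[symmetric] algebra_simps)
    then have Sz: "S *v z = join_vec 0 (C *v x + D *v (\<i> *s x))"
      by (simp add: block z_def block_vec x)
    have "herm_form z = 2 * (\<Sum>k\<in>UNIV. (cmod (x $ k))\<^sup>2)"
      unfolding z_def herm_form_def cnj_vec_simps sympl_form_join
      by (simp add: bilin_dot_def cnj_vec_def sum_distrib_left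
        cmod_def power2_eq_square sum_subtractf[symmetric] sum.distrib[symmetric] algebra_simps)
    moreover have "herm_form z = 0"
      unfolding herm_form_real_Sp[OF S re, symmetric, of z] Sz
      unfolding herm_form_def cnj_vec_simps sympl_form_join by (simp add: bilin_dot_def cnj_vec_def)
    ultimately have "x = 0"
      by (simp add: sum_nonneg_eq_0_iff vec_eq_iff)
    with x show False by simp
  qed
  then obtain t :: real where t: "det (\<chi> k l. A $ k $ l + of_real t * B $ k $ l) \<noteq> 0"
    unfolding M_def by (rule real_shift_invertible)
  define T :: "complex^'a^'a" where "T = mat (of_real t)"
  have T: "transpose T = T" "cnj_mat T = T"
    by (simp add: T_def transpose_mat) (simp add: T_def cnj_mat_def vec_eq_iff mat_def)
  define S' where "S' = S ** V_mat T"
  have S': "S' = block_matrix (A + B ** T) B (C + D ** T) D"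
    by (simp add: S'_def block V_mat_def block_mult)
  have "A + B ** T = (\<chi> k l. A $ k $ l + of_real t * B $ k $ l)"
    by (simp add: T_def vec_eq_iff matrix_matrix_mult_def mat_def if_distrib sum.If_cases mult.commute cong: if_cong)
  then have "det (A + B ** T) \<noteq> 0" using t by simp
  moreover have "S' \<in> Sp"
    using T(1) by (simp add: S'_def Sp_mult S V_mat_Sp)
  moreover have "cnj_mat S' = S'"
    using re T(2) by (simp add: S'_def cnj_mat_mult V_mat_def)
  ultimately have "S' \<in> generated"
    unfolding S' by (intro real_Sp_generated_free)
  moreover have "V_mat (- T) \<in> generated"
    using T by (intro V_mat_real_generated) simp_all
  moreover have "S = S' ** V_mat (- T)"
    by (simp add: S'_def matrix_mul_assoc[symmetric] V_mat_mult V_mat_0)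
  ultimately show ?thesis by (simp add: semigroup_generated.product)
qed

section \<open>Reduction of a positive matrix to a real one\<close>

lemma Sp_inverse:
  assumes "S \<in> Sp" obtains R where "S ** R = mat 1" "R ** S = mat 1"
proof -
  have "J_inv ** J_mat = mat 1" by (simp add: J_mat_J_inv matrix_left_right_inverse)
  then have "(J_inv ** transpose S ** J_mat) ** S = mat 1"
    using assms by (simp add: Sp_def matrix_mul_assoc[symmetric])
  then show ?thesis using that matrix_left_right_inverse by blast
qed

text \<open>
  Real vectors include the standard basis, whose images are the columns.
\<close>

lemma real_matrixI:
  assumes "\<And>y. cnj_vec y = y \<Longrightarrow> cnj_vec (A *v y) = A *v y"
  shows "cnj_mat A = A"
proof -
  have "cnj_vec (A *v axis k 1) = A *v axis k 1" for k
    by (rule assms) (simp add: cnj_vec_def axis_def vec_eq_iff)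
  moreover have "(A *v axis k 1) $ i = A $ i $ k" for i k
    by (simp add: matrix_vector_mult_def axis_def if_distrib sum.If_cases cong: if_cong)
  ultimately show ?thesis
    by (simp add: cnj_vec_def cnj_mat_def vec_eq_iff)
qed

text \<open>
  The hypothesis says that \<open>S\<^sup>-\<^sup>1\<close> preserves real vectors, so \<open>S\<^sup>-\<^sup>1\<close> is real, and with it \<open>S\<close>.
\<close>

lemma Sp_realI:
  assumes S: "S \<in> Sp" and real: "\<And>u. cnj_vec (S *v u) = S *v u \<Longrightarrow> cnj_vec u = u"
  shows "cnj_mat S = S"
proof -
  obtain R where R: "S ** R = mat 1" "R ** S = mat 1" using Sp_inverse[OF S] .
  have "cnj_mat R = R"
    by (rule real_matrixI, rule real) (simp add: matrix_vector_mul_assoc R)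
  then have "cnj_mat S ** R = mat 1"
    by (metis R(1) cnj_mat_mult cnj_mat_simps(2))
  then show ?thesis
    by (metis R(2) matrix_mul_assoc matrix_mul_lid matrix_mul_rid)
qed

lemma real_dom_subspace: "subspace (real_dom S)"
proof -
  have r: "r *\<^sub>R z = complex_of_real r *s z" for r and z :: "complex^'n"
    unfolding vec_eq_iff vector_scaleR_component vector_smult_component
    by (simp add: scaleR_conv_of_real)
  show ?thesis
    unfolding subspace_def real_dom_def r
    by (auto simp: matrix_vector_right_distrib vec.scale) (simp_all add: cnj_vec_def vec_eq_iff)
qed

text \<open>
  Transvections are split off until no nonreal vector has a real image. The process ends because the
  real dimension of \<open>real_dom S\<close> is bounded, and it ends at a real symplectic matrix.
\<close>

lemma Sp_plus_generated:
  assumes "S \<in> Sp" "\<And>z. herm_form z \<le> herm_form (S *v z)"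
  shows "S \<in> generated"
  using assms
proof (induction "DIM(complex^('a + 'a)) - dim (real_dom S)" arbitrary: S rule: less_induct)
  case less
  show ?case
  proof (cases "\<exists>u. cnj_vec (S *v u) = S *v u \<and> cnj_vec u \<noteq> u")
    case True
    then obtain u where "cnj_vec (S *v u) = S *v u" "cnj_vec u \<noteq> u" by blast
    then obtain a \<beta> S' where *: "cnj_vec a = a" "\<beta> \<ge> 0" "S = S' ** transvection (- \<i> * of_real \<beta>) a"
      "S' \<in> Sp" "\<And>z. herm_form z \<le> herm_form (S' *v z)" "real_dom S \<subset> real_dom S'"
      using transvection_peel[OF less.prems] by metis
    have "dim (real_dom S) < dim (real_dom S')"
      using *(6) by (intro dim_psubset) (simp add: span_eq_iff[THEN iffD2, OF real_dom_subspace])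
    moreover have "dim (real_dom S') \<le> DIM(complex^('a + 'a))" by (rule dim_subset_UNIV)
    ultimately have "S' \<in> generated"
      by (intro less.hyps *) linarith
    moreover have "transvection (- \<i> * of_real \<beta>) a \<in> generated"
      using * by (intro transvection_generated) simp_all
    ultimately show ?thesis
      unfolding *(3) by (rule semigroup_generated.product)
  next
    case False
    then show ?thesis using less.prems(1) by (intro real_Sp_generated Sp_realI) auto
  qed
qed

section \<open>The generators are positive\<close>

text \<open>
  The increment is \<open>2 Im (Q x \<cdot> cnj x)\<close>. For \<open>x = a + \<i> b\<close> with real \<open>a\<close>, \<open>b\<close>, symmetry of \<open>Q\<close> cancels the
  cross terms, and the values of the quadratic form \<open>Im Q\<close> at \<open>a\<close> and \<open>b\<close> remain.
\<close>

lemma V_mat_positive: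
  assumes Q: "transpose Q = Q" "pos_semidef (map_matrix Im Q)"
  shows "herm_form z \<le> herm_form (V_mat Q *v z)"
proof (rule join_vec_cases[of z])
  fix x y assume z: "z = join_vec x y"
  define a where "a = (\<chi> k. Re (x $ k))"
  define b where "b = (\<chi> k. Im (x $ k))"
  define c where "c = (\<lambda>v::real^'a. (\<chi> k. complex_of_real (v $ k)))"
  have x: "x = c a + \<i> *s c b" and cx: "cnj_vec x = c a - \<i> *s c b"
    by (simp_all add: a_def b_def c_def cnj_vec_def vec_eq_iff complex_eq_iff)
  have "bilin_dot (Q *v x) (cnj_vec x) = bilin_dot (Q *v c a) (c a) + bilin_dot (Q *v c b) (c b)
    + \<i> * (bilin_dot (Q *v c b) (c a) - bilin_dot (Q *v c a) (c b))"
    unfolding cx unfolding x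
    by (simp add: matrix_vector_right_distrib vec.scale bilin_dot_def sum.distrib[symmetric] sum_subtractf[symmetric] sum_distrib_left algebra_simps)
  also have "bilin_dot (Q *v c b) (c a) = bilin_dot (Q *v c a) (c b)"
    unfolding bilin_dot_transpose[of Q "c b"] Q(1) by (simp add: bilin_dot_def mult.commute)
  finally have "Im (bilin_dot (Q *v x) (cnj_vec x)) = Im (bilin_dot (Q *v c a) (c a)) + Im (bilin_dot (Q *v c b) (c b))"
    by simp
  moreover have "Im (bilin_dot (Q *v c v) (c v)) = v \<bullet> (map_matrix Im Q *v v)" for v
    by (simp add: bilin_dot_def c_def matrix_vector_mult_def inner_vec_def mult.commute)
  moreover have "herm_form (V_mat Q *v z) = herm_form z + 2 * Im (bilin_dot (Q *v x) (cnj_vec x))"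
    by (simp add: z V_mat_def block_vec herm_form_def sympl_form_join)
       (simp add: bilin_dot_def algebra_simps sum.distrib sum_subtractf cnj_vec_def)
  ultimately show ?thesis using Q(2) by (simp add: pos_semidef_def)
qed

lemma generated_Sp_plus: "S \<in> generated \<Longrightarrow> S \<in> Sp \<and> (\<forall>z. herm_form z \<le> herm_form (S *v z))"
proof (induction rule: semigroup_generated.induct)
  case (generator S)
  have J: "cnj_mat J_mat = J_mat" by (simp add: J_mat_def)
  have D: "cnj_mat (D_mat E) = D_mat E" for E by (simp add: D_mat_def map_of_real_simps)
  show ?case
    using generator
    by (auto simp: Sp_plus_generators_def J_mat_Sp V_mat_Sp D_mat_Sp V_mat_positive herm_form_real_Sp J D)
next
  case (product A B)
  then show ?case
    by (auto simp: Sp_mult matrix_vector_mul_assoc[symmetric] intro: order_trans)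
qed

theorem proposition1p3:
  "(Sp_plus :: (complex^('d::finite + 'd)^('d + 'd)) set) =
     semigroup_generated
       ({J_mat} \<union> {D_mat E | E. invertible E}
        \<union> {V_mat Q | Q. transpose Q = Q \<and> pos_semidef (map_matrix Im Q)})"
  unfolding Sp_plus_generators_def[symmetric]
  by (auto simp: Sp_plus_iff intro: Sp_plus_generated dest: generated_Sp_plus)

end
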